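(* Let $K$ be an arbitrary field. Any 2-dimensional endo-commutative straight algebra of type I over $K$ is commutative, but is neither unital nor associative.
   Context: $K$ is an arbitrary field. An algebra over $K$ is a $K$-vector space with a $K$-bilinear multiplication, not assumed associative, commutative or unital. An algebra $A$ is endo-commutative if $x^2y^2=(xy)^2$ for all $x,y\in A$. A 2-dimensional algebra is curled if $x^2$ is a scalar multiple of $x$ for every element $x$; otherwise it is straight. For $(p,q,a,b,c,d)\in K^6$, $S(p,q,a,b,c,d)$ denotes the (straight) algebra over $K$ with linear base $\{e,f\}$ and multiplication $e^2=f$, $ef=ae+bf$, $fe=ce+df$, $f^2=pe+qf$. An endo-commutative straight algebra of type I over $K$ is an endo-commutative algebra of the form $S(p,q,a,b,c,d)$ for which exactly one of $p,a,c$ is nonzero. *)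

theory Defs
  imports Complex_Main
begin

locale nonassoc_algebra = vector_space scale
  for scale :: "'k::field \<Rightarrow> 'v::ab_group_add \<Rightarrow> 'v" (infixr "*s" 75) +
  fixes mult :: "'v \<Rightarrow> 'v \<Rightarrow> 'v" (infixl "\<bullet>" 70)
  assumes linear_mult_left: "Vector_Spaces.linear scale scale (\<lambda>x. x \<bullet> y)"
    and linear_mult_right: "Vector_Spaces.linear scale scale (\<lambda>y. x \<bullet> y)"
begin

definition commutative :: bool where
  "commutative \<longleftrightarrow> (\<forall>x y. x \<bullet> y = y \<bullet> x)"

definition associative :: bool where
  "associative \<longleftrightarrow> (\<forall>x y z. (x \<bullet> y) \<bullet> z = x \<bullet> (y \<bullet> z))"

definition unital :: bool where
  "unital \<longleftrightarrow> (\<exists>u. \<forall>x. u \<bullet> x = x \<and> x \<bullet> u = x)"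

definition endo_commutative :: bool where
  "endo_commutative \<longleftrightarrow> (\<forall>x y. (x \<bullet> x) \<bullet> (y \<bullet> y) = (x \<bullet> y) \<bullet> (x \<bullet> y))"

definition curled :: bool where
  "curled \<longleftrightarrow> dim UNIV = 2 \<and> (\<forall>x. \<exists>k. x \<bullet> x = k *s x)"

definition straight :: bool where
  "straight \<longleftrightarrow> dim UNIV = 2 \<and> \<not> curled"

text \<open>The algebra is (up to the choice of the base) \<open>S(p,q,a,b,c,d)\<close>.\<close>

definition of_form_S :: "'k \<Rightarrow> 'k \<Rightarrow> 'k \<Rightarrow> 'k \<Rightarrow> 'k \<Rightarrow> 'k \<Rightarrow> bool" where
  "of_form_S p q a b c d \<longleftrightarrow>
     (\<exists>e f. e \<noteq> f \<and> independent {e, f} \<and> span {e, f} = UNIV \<and>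
        e \<bullet> e = f \<and>
        e \<bullet> f = a *s e + b *s f \<and>
        f \<bullet> e = c *s e + d *s f \<and>
        f \<bullet> f = p *s e + q *s f)"

text \<open>Straightness and dimension two are not repeated here: every algebra of the form
  \<open>S(p,q,a,b,c,d)\<close> has both, see \<open>of_form_S_straight\<close> below.\<close>

definition endo_commutative_straight_type_I :: bool where
  "endo_commutative_straight_type_I \<longleftrightarrow>
     endo_commutative \<and>
     (\<exists>p q a b c d. of_form_S p q a b c d \<and>
        ((p \<noteq> 0 \<and> a = 0 \<and> c = 0) \<or> (p = 0 \<and> a \<noteq> 0 \<and> c = 0) \<or> (p = 0 \<and> a = 0 \<and> c \<noteq> 0)))"

lemma of_form_S_dim:
  assumes "of_form_S p q a b c d"
  shows "dim UNIV = 2"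
proof -
  obtain e f where "e \<noteq> f" "independent {e, f}" "span {e, f} = UNIV"
    using assms unfolding of_form_S_def by blast
  then show ?thesis
    using dim_eq_card[of "{e, f}" UNIV] by simp
qed

lemma of_form_S_straight:
  assumes "of_form_S p q a b c d"
  shows "straight"
proof -
  obtain e f where ef: "e \<noteq> f" "independent {e, f}" "e \<bullet> e = f"
    using assms unfolding of_form_S_def by blast
  have "\<not> curled"
  proof
    assume "curled"
    then obtain k where "e \<bullet> e = k *s e"
      unfolding curled_def by blast
    then have "f \<in> span {e}"
      using ef(3) by (simp add: span_base span_scale)
    moreover have "f \<notin> span ({f, e} - {f})"
      using ef(2) unfolding dependent_def by (auto simp: insert_commute)
    moreover have "{f, e} - {f} = {e}"
      using ef(1) by auto
    ultimately show False by simp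
  qed
  then show ?thesis
    unfolding straight_def using of_form_S_dim[OF assms] by simp
qed

end

end

theory Submission imports Defs begin

text \<open>Linearizing \<open>e\<^sup>2 y\<^sup>2 = (e y)\<^sup>2\<close> at \<open>y = e + f\<close> gives \<open>f(fe) = (ef)f\<close>. If \<open>p = 0\<close> and exactly
  one of \<open>a\<close>, \<open>c\<close> is nonzero, the \<open>e\<close>-coordinates of the two sides, \<open>c\<^sup>2\<close> and \<open>a\<^sup>2\<close>, differ. So \<open>a = c = 0\<close> and
  \<open>p \<noteq> 0\<close>; then \<open>f f\<^sup>2 = (ef)\<^sup>2\<close> and \<open>f\<^sup>2 f = (fe)\<^sup>2\<close> yield \<open>q = b\<^sup>2 = d\<^sup>2\<close> and \<open>pd = pb = 0\<close>.
  What remains is \<open>e\<^sup>2 = f\<close>, \<open>ef = fe = 0\<close>, \<open>f\<^sup>2 = pe\<close>.\<close>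

context nonassoc_algebra
begin

lemma mult_add_left: "(x + y) \<bullet> z = x \<bullet> z + y \<bullet> z"
  using Vector_Spaces.linear.axioms(3)[OF linear_mult_left] by (rule module_hom.add)

lemma mult_add_right: "x \<bullet> (y + z) = x \<bullet> y + x \<bullet> z"
  using Vector_Spaces.linear.axioms(3)[OF linear_mult_right] by (rule module_hom.add)

lemma mult_scale_left: "(k *s x) \<bullet> z = k *s (x \<bullet> z)"
  using Vector_Spaces.linear.axioms(3)[OF linear_mult_left] by (rule module_hom.scale)

lemma mult_scale_right: "x \<bullet> (k *s z) = k *s (x \<bullet> z)"
  using Vector_Spaces.linear.axioms(3)[OF linear_mult_right] by (rule module_hom.scale)

lemma mult_zero_left: "0 \<bullet> z = 0"
  using mult_scale_left[of 0 0 z] by simp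

lemma mult_zero_right: "x \<bullet> 0 = 0"
  using mult_scale_right[of x 0 0] by simp

lemmas mult_bilinear = mult_add_left mult_add_right mult_scale_left mult_scale_right
  mult_zero_left mult_zero_right

lemma span_pairE:
  assumes "span {e, f} = UNIV"
  obtains k l where "x = k *s e + l *s f"
proof -
  have "x \<in> span {e, f}" using assms by simp
  then obtain k where "x - k *s e \<in> span {f}" by (auto simp: span_insert[of e])
  then obtain l where "x - k *s e = l *s f" by (auto simp: span_singleton)
  then have "x = k *s e + l *s f" by (simp add: algebra_simps)
  then show thesis by (rule that)
qed

lemma independent_pair_coeffs_eq:
  assumes "independent {e, f}" "e \<noteq> f" "k *s e + l *s f = m *s e + n *s f"
  shows "k = m \<and> l = n"
proof -
  have "(k - m) *s e + (l - n) *s f = 0"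
    using assms(3) by (simp add: scale_left_diff_distrib algebra_simps)
  \<comment> \<open>The relation is recast as a sum over the set \<open>{e, f}\<close>;
    \<open>e \<noteq> f\<close> keeps its two coefficients apart.\<close>
  then have "(\<Sum>v\<in>{e, f}. (if v = e then k - m else l - n) *s v) = 0"
    using assms(2) by simp
  from independentD[OF assms(1) _ subset_refl this] assms(2) show ?thesis by fastforce
qed

text \<open>Expand the identity at \<open>y + z\<close> and cancel its instances at \<open>y\<close>
  and \<open>z\<close>. No division by 2 occurs, so every characteristic is covered.\<close>

lemma endo_commutative_linearized:
  assumes "endo_commutative"
  shows "(x \<bullet> x) \<bullet> (y \<bullet> z + z \<bullet> y) = (x \<bullet> y) \<bullet> (x \<bullet> z) + (x \<bullet> z) \<bullet> (x \<bullet> y)"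
proof -
  have "(x \<bullet> x) \<bullet> (v \<bullet> v) = (x \<bullet> v) \<bullet> (x \<bullet> v)" for v
    using assms unfolding endo_commutative_def by blast
  from this[of "y + z"] this[of y] this[of z] show ?thesis
    by (simp add: mult_add_left mult_add_right algebra_simps)
qed

lemma type_I_normal_form:
  assumes "endo_commutative_straight_type_I"
  obtains e f p where "e \<noteq> f" "independent {e, f}" "span {e, f} = UNIV" "p \<noteq> 0"
    "e \<bullet> e = f" "e \<bullet> f = 0" "f \<bullet> e = 0" "f \<bullet> f = p *s e"
proof -
  obtain p q a b c d where S: "of_form_S p q a b c d" and endo: "endo_commutative"
    and type_I: "(p \<noteq> 0 \<and> a = 0 \<and> c = 0) \<or> (p = 0 \<and> a \<noteq> 0 \<and> c = 0) \<or> (p = 0 \<and> a = 0 \<and> c \<noteq> 0)"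
    using assms unfolding endo_commutative_straight_type_I_def by blast
  obtain e f where ne: "e \<noteq> f" and ind: "independent {e, f}" and sp: "span {e, f} = UNIV"
    and ee: "e \<bullet> e = f" and ef: "e \<bullet> f = a *s e + b *s f"
    and fe: "f \<bullet> e = c *s e + d *s f" and ff: "f \<bullet> f = p *s e + q *s f"
    using S unfolding of_form_S_def by blast
  note coeffs = independent_pair_coeffs_eq[OF ind ne]
  \<comment> \<open>Both sides of the linearized identity contain
    \<open>f \<bullet> (e \<bullet> f)\<close>, which cancels.\<close>
  have "f \<bullet> (f \<bullet> e) = (e \<bullet> f) \<bullet> f"
    using endo_commutative_linearized[OF endo, of e e f] by (simp add: ee mult_add_right)
  then have "(c * c + d * p) *s e + (c * d + d * q) *s f = (a * a + b * p) *s e + (a * b + b * q) *s f"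
    by (simp add: ef fe ff mult_bilinear scale_right_distrib scale_left_distrib algebra_simps)
  from coeffs[OF this] type_I have p: "p \<noteq> 0" and ac: "a = 0" "c = 0" by auto
  have "f \<bullet> (f \<bullet> f) = (e \<bullet> f) \<bullet> (e \<bullet> f)"
    using endo ee unfolding endo_commutative_def by metis
  then have "(q * p) *s e + (p * d + q * q) *s f = (b * b * p) *s e + (b * b * q) *s f"
    by (simp add: ef fe ff ac mult_bilinear scale_right_distrib scale_left_distrib algebra_simps)
  \<comment> \<open>Cancelling \<open>p\<close> in the \<open>e\<close>-coordinates gives
    \<open>q\<close>; then \<open>q * q = b * b * q\<close>, so the \<open>f\<close>-coordinates
    leave \<open>p * d = 0\<close>.\<close>
  from coeffs[OF this] p have q: "q = b * b" and d: "d = 0" by auto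
  have "(f \<bullet> f) \<bullet> f = (f \<bullet> e) \<bullet> (f \<bullet> e)"
    using endo ee unfolding endo_commutative_def by metis
  \<comment> \<open>The right side vanishes because \<open>c = d = 0\<close> makes
    \<open>f \<bullet> e = 0\<close>.\<close>
  then have "(q * p) *s e + (p * b + q * q) *s f = 0 *s e + 0 *s f"
    by (simp add: ef fe ff ac d mult_bilinear scale_right_distrib scale_left_distrib algebra_simps)
  from coeffs[OF this] p have "q = 0" "b = 0" by auto
  with that[OF ne ind sp p ee] show thesis by (simp add: ef fe ff ac d)
qed

lemma type_I_commutative_not_unital_not_associative:
  assumes "endo_commutative_straight_type_I"
  shows "commutative \<and> \<not> unital \<and> \<not> associative"
proof -
  obtain e f p where ne: "e \<noteq> f" and ind: "independent {e, f}" and sp: "span {e, f} = UNIV"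
    and p: "p \<noteq> 0" and ee: "e \<bullet> e = f" and ef: "e \<bullet> f = 0" and fe: "f \<bullet> e = 0"
    and ff: "f \<bullet> f = p *s e"
    using type_I_normal_form[OF assms] by blast
  note table = ee ef fe ff
  have "x \<bullet> y = y \<bullet> x" for x y
  proof -
    obtain k l where x: "x = k *s e + l *s f" using sp by (rule span_pairE)
    obtain m n where y: "y = m *s e + n *s f" using sp by (rule span_pairE)
    \<comment> \<open>Only the squares of \<open>e\<close> and \<open>f\<close> survive, with
      coefficients \<open>k * m\<close> and \<open>l * n\<close>, which are symmetric in the two
      factors.\<close>
    show ?thesis by (simp add: x y table mult_bilinear mult.commute)
  qed
  then have "commutative" unfolding commutative_def by blast
  moreover have "\<not> unital"
  proof
    assume "unital"
    then obtain u where u: "u \<bullet> e = e" unfolding unital_def by blast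
    obtain k l where "u = k *s e + l *s f" using sp by (rule span_pairE)
    \<comment> \<open>Right multiplication by \<open>e\<close> maps everything into the line of
      \<open>f\<close>, so no \<open>u\<close> can fix \<open>e\<close>.\<close>
    with u have "0 *s e + k *s f = 1 *s e + 0 *s f" by (simp add: table mult_bilinear)
    from independent_pair_coeffs_eq[OF ind ne this] show False by simp
  qed
  moreover have "\<not> associative"
  proof
    assume "associative"
    \<comment> \<open>On this triple the left side is \<open>f \<bullet> f = p *s e\<close>, while
      the right side is \<open>e \<bullet> 0 = 0\<close>.\<close>
    then have "(e \<bullet> e) \<bullet> f = e \<bullet> (e \<bullet> f)" unfolding associative_def by blast
    then have "p *s e + 0 *s f = 0 *s e + 0 *s f" by (simp add: table mult_bilinear)
    from independent_pair_coeffs_eq[OF ind ne this] p show False by simp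
  qed
  ultimately show ?thesis by blast
qed

end

theorem corollary2:
  fixes scale :: "'k::field \<Rightarrow> 'v::ab_group_add \<Rightarrow> 'v"
    and mult :: "'v \<Rightarrow> 'v \<Rightarrow> 'v"
  assumes "nonassoc_algebra scale mult"
    and "nonassoc_algebra.endo_commutative_straight_type_I scale mult"
  shows "nonassoc_algebra.commutative mult
    \<and> \<not> nonassoc_algebra.unital mult
    \<and> \<not> nonassoc_algebra.associative mult"
  using assms by (rule nonassoc_algebra.type_I_commutative_not_unital_not_associative)

end
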